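(* Consider the problem $$\text{minimize}_{Y}\;\; f(Y)+\gamma\, g(Y)\quad\text{subject to}\quad X(Y)\succ 0,$$ over $Y\in\mathbb{C}^{m\times n}$, with $\gamma>0$ and with $X(\cdot)$, $f$, $g$ and $\mathcal{D}_s$ as defined in the context. Let $Y^0\in\mathcal{D}_s$ and let $a$ be a real number with $a> f(Y^0)+\gamma\, g(Y^0)$. Let $\mathcal{D}(a)=\{Y\in\mathcal{D}_s\mid f(Y)\le a\}$, and let $\mu_a>0$ and $L_a>0$ be, respectively, a strong convexity modulus of $f$ over $\mathcal{D}(a)$ and a Lipschitz constant of $\nabla f$ over $\mathcal{D}(a)$. Let $\alpha\in[0,1/L_a]$. Then the iterates of the proximal gradient algorithm $$Y^{k+1}=\mathbf{prox}_{\gamma\alpha g}\big(Y^k-\alpha\nabla f(Y^k)\big),\qquad k=0,1,2,\dots$$ started at $Y^0$ satisfy, for all $k\ge 0$, $$\|Y^{k+1}-Y^\star\|_F^2\;\le\;(1-\mu_a\alpha)\,\|Y^k-Y^\star\|_F^2,$$ where $Y^\star$ is the globally optimal solution of the problem.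
   Context: Problem data: $A\in\mathbb{C}^{n\times n}$, $B\in\mathbb{C}^{n\times m}$ with $m\le n$, the pair $(A,B)$ controllable; $V=V^*\succ0$ and $Q=Q^*\succ 0$ in $\mathbb{C}^{n\times n}$, $R=R^*\succ0$ in $\mathbb{C}^{m\times m}$. Define the linear operators $\mathcal{A}_1(X)=AX+XA^*$ on $\mathbb{C}^{n\times n}$ and $\mathcal{B}(Y)=BY+Y^*B^*$ from $\mathbb{C}^{m\times n}$ to $\mathbb{C}^{n\times n}$ ($\mathcal{B}$ is real-linear). Standing assumption: $\mathcal{A}_1$ is invertible. For $Y\in\mathbb{C}^{m\times n}$ set $X(Y)=\mathcal{A}_1^{-1}(\mathcal{B}(Y)-V)$, i.e. $X(Y)$ is the unique solution of $\mathcal{A}_1(X)-\mathcal{B}(Y)+V=0$. Let $$\mathcal{D}_s=\{Y\in\mathbb{C}^{m\times n}\mid X(Y)\succ0\},$$ and for $Y\in\mathcal{D}_s$ let $$f(Y)=\mathrm{trace}\big(Q\,X(Y)+Y^*RY\,X(Y)^{-1}\big).$$ The regularizer is $g(Y)=\sum_{i=1}^m w_i\|\mathrm{e}_i^*Y\|_2$, where $w_i>0$ are given weights and $\mathrm{e}_i$ is the $i$th unit vector of $\mathbb{R}^m$. $\|\cdot\|_F$ is the Frobenius norm; $\mathbb{C}^{m\times n}$ is regarded as a real inner product space with $\langle M_1,M_2\rangle=\mathrm{Re}\,\mathrm{trace}(M_1^*M_2)$, and $\nabla f$ is the gradient with respect to it. Strong convexity of $f$ over a convex set with modulus $\mu$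 means $f-\frac{\mu}{2}\|\cdot\|_F^2$ is convex on that set. The proximal operator of a proper closed convex function $h$ is $\mathbf{prox}_h(Z)=\mathrm{argmin}_Y\big(h(Y)+\frac12\|Y-Z\|_F^2\big)$. The assertion for all $k$ includes that every iterate lies in $\mathcal{D}_s$, so that $\nabla f(Y^k)$ is defined. *)

theory Defs
  imports "HOL-Analysis.Analysis"
begin

text \<open>
  A complex matrix with \<open>m\<close> rows and \<open>n\<close> columns has type \<^typ>\<open>complex^'n^'m\<close>. The type-class
  inner product and norm on this type are the real inner product
  \<open>Re trace (M\<^sub>1\<^sup>* M\<^sub>2)\<close> and the Frobenius norm; see \<open>inner_eq_Re_trace\<close> and
  \<open>norm_eq_frobenius\<close> below.
\<close>

definition ctranspose :: "complex^'n^'m \<Rightarrow> complex^'m^'n" where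
  "ctranspose M = (\<chi> i j. cnj (M $ j $ i))"

lemma inner_eq_Re_trace:
  fixes M1 M2 :: "complex^'n^'m"
  shows "inner M1 M2 = Re (trace (ctranspose M1 ** M2))"
proof -
  have "Re (trace (ctranspose M1 ** M2))
      = (\<Sum>j\<in>UNIV. \<Sum>i\<in>UNIV. Re (cnj (M1 $ i $ j) * M2 $ i $ j))"
    by (simp add: trace_def matrix_matrix_mult_def ctranspose_def)
  also have "\<dots> = (\<Sum>i\<in>UNIV. \<Sum>j\<in>UNIV. Re (cnj (M1 $ i $ j) * M2 $ i $ j))"
    by (rule sum.swap)
  also have "\<dots> = inner M1 M2"
    by (simp add: inner_vec_def inner_complex_def)
  finally show ?thesis by simp
qed

lemma norm_eq_frobenius:
  fixes M :: "complex^'n^'m"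
  shows "norm M = sqrt (\<Sum>i\<in>UNIV. \<Sum>j\<in>UNIV. (cmod (M $ i $ j))\<^sup>2)"
  by (simp add: norm_vec_def L2_set_def sum_nonneg)

definition pos_def :: "complex^'n^'n \<Rightarrow> bool" where
  "pos_def M \<longleftrightarrow> ctranspose M = M \<and>
     (\<forall>v. v \<noteq> 0 \<longrightarrow> 0 < Re (\<Sum>i\<in>UNIV. cnj (v $ i) * (M *v v) $ i))"

text \<open>
  Controllability of the system \<open>x' = A x + B u\<close>: some continuous input steers any initial state
  to any final state in finite time.
\<close>

definition controllable :: "complex^'n^'n \<Rightarrow> complex^'m^'n \<Rightarrow> bool" where
  "controllable A B \<longleftrightarrow>
     (\<forall>x0 x1. \<exists>T>0. \<exists>(u :: real \<Rightarrow> complex^'m) (x :: real \<Rightarrow> complex^'n).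
        continuous_on {0..T} u \<and> x 0 = x0 \<and> x T = x1 \<and>
        (\<forall>t\<in>{0..T}. (x has_vector_derivative A *v x t + B *v u t) (at t within {0..T})))"

definition lyap_op :: "complex^'n^'n \<Rightarrow> complex^'n^'n \<Rightarrow> complex^'n^'n" where
  "lyap_op A X = A ** X + X ** ctranspose A"

definition input_op :: "complex^'m^'n \<Rightarrow> complex^'n^'m \<Rightarrow> complex^'n^'n" where
  "input_op B Y = B ** Y + ctranspose Y ** ctranspose B"

definition X_of ::
  "complex^'n^'n \<Rightarrow> complex^'m^'n \<Rightarrow> complex^'n^'n \<Rightarrow> complex^'n^'m \<Rightarrow> complex^'n^'n" where
  "X_of A B V Y = inv (lyap_op A) (input_op B Y - V)"

definition stab_dom ::
  "complex^'n^'n \<Rightarrow> complex^'m^'n \<Rightarrow> complex^'n^'n \<Rightarrow> (complex^'n^'m) set" where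
  "stab_dom A B V = {Y. pos_def (X_of A B V Y)}"

text \<open>
  For Hermitian \<open>Q\<close> and \<open>R\<close> the trace below is real at every \<open>Y\<close> in \<^const>\<open>stab_dom\<close>; taking the
  real part only adjusts the type. Outside \<^const>\<open>stab_dom\<close> the value has no meaning.
\<close>

definition cost ::
  "complex^'n^'n \<Rightarrow> complex^'m^'n \<Rightarrow> complex^'n^'n \<Rightarrow> complex^'n^'n \<Rightarrow> complex^'m^'m \<Rightarrow>
   complex^'n^'m \<Rightarrow> real" where
  "cost A B V Q R Y =
     Re (trace (Q ** X_of A B V Y + ctranspose Y ** R ** Y ** matrix_inv (X_of A B V Y)))"

definition cost_sublevel ::
  "complex^'n^'n \<Rightarrow> complex^'m^'n \<Rightarrow> complex^'n^'n \<Rightarrow> complex^'n^'n \<Rightarrow> complex^'m^'m \<Rightarrow>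
   real \<Rightarrow> (complex^'n^'m) set" where
  "cost_sublevel A B V Q R a = {Y \<in> stab_dom A B V. cost A B V Q R Y \<le> a}"

definition row_reg :: "('m \<Rightarrow> real) \<Rightarrow> complex^'n^'m \<Rightarrow> real" where
  "row_reg w Y = (\<Sum>i\<in>UNIV. w i * norm (row i Y))"

definition grad :: "('a::real_inner \<Rightarrow> real) \<Rightarrow> 'a \<Rightarrow> 'a" where
  "grad f x = (THE D. GDERIV f x :> D)"

definition strongly_convex_on :: "'a::real_normed_vector set \<Rightarrow> ('a \<Rightarrow> real) \<Rightarrow> real \<Rightarrow> bool" where
  "strongly_convex_on S f \<mu> \<longleftrightarrow> convex_on S (\<lambda>x. f x - \<mu> / 2 * (norm x)\<^sup>2)"

definition prox :: "('a::real_normed_vector \<Rightarrow> real) \<Rightarrow> 'a \<Rightarrow> 'a" where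
  "prox h z = (ARG_MIN (\<lambda>y. h y + 1 / 2 * (norm (y - z))\<^sup>2) y. True)"

end

theory Submission
  imports Defs
begin

text \<open>
  On the sublevel set \<open>D(a)\<close> the usual argument applies: the prox inequality, the descent lemma (step
  \<open>\<alpha> \<le> 1 / L\<close>) and the first-order inequality of strong convexity add up to the contraction. What
  needs work is that the iterates stay in \<open>D(a)\<close> and that a minimizer exists. Both follow once \<open>D(a)\<close>
  is closed, which rests on the inequality
  \<open>v\<^sup>* Y\<^sup>* R Y v \<le> trace (Y\<^sup>* R Y X\<inverse>) \<cdot> v\<^sup>* X v\<close>: if \<open>Y\<close> is a limit of points of \<open>D(a)\<close> and
  \<open>v\<^sup>* X(Y) v = 0\<close>, then \<open>X(Y) v = 0\<close> and \<open>Y v = 0\<close>, so the Lyapunov equation gives \<open>v\<^sup>* V v = 0\<close>.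
\<close>

subsection \<open>Proximal gradient steps on a sublevel set\<close>

lemma norm_convex_combination:
  fixes x y :: "'a::real_inner"
  shows "(norm ((1 - t) *\<^sub>R x + t *\<^sub>R y))\<^sup>2
    = (1 - t) * (norm x)\<^sup>2 + t * (norm y)\<^sup>2 - t * (1 - t) * (norm (y - x))\<^sup>2"
  by (simp only: power2_norm_eq_inner) (simp add: inner_simps inner_commute algebra_simps)

lemma strongly_convex_onD:
  fixes f :: "'a::real_inner \<Rightarrow> real"
  assumes "strongly_convex_on S f \<mu>" "x \<in> S" "y \<in> S" "0 \<le> t" "t \<le> 1"
  shows "f ((1 - t) *\<^sub>R x + t *\<^sub>R y)
    \<le> (1 - t) * f x + t * f y - \<mu> / 2 * t * (1 - t) * (norm (y - x))\<^sup>2"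
proof -
  define z where "z = (1 - t) *\<^sub>R x + t *\<^sub>R y"
  have "f z - \<mu> / 2 * (norm z)\<^sup>2
     \<le> (1 - t) * (f x - \<mu> / 2 * (norm x)\<^sup>2) + t * (f y - \<mu> / 2 * (norm y)\<^sup>2)"
    using convex_onD[OF assms(1)[unfolded strongly_convex_on_def] assms(4,5,2,3)] by (simp add: z_def)
  moreover have "(norm z)\<^sup>2
      = (1 - t) * (norm x)\<^sup>2 + t * (norm y)\<^sup>2 - t * (1 - t) * (norm (y - x))\<^sup>2"
    unfolding z_def by (rule norm_convex_combination)
  ultimately show ?thesis
    unfolding z_def[symmetric] by (simp add: field_simps)
qed

lemma strongly_convex_on_imp_convex:
  "strongly_convex_on S f \<mu> \<Longrightarrow> convex S"
  by (simp add: strongly_convex_on_def convex_on_def)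

text \<open>Let \<open>t\<close> tend to 0 from the right. This removes the factor
  \<open>1 - t\<close> that strong convexity leaves at interior points of a segment.\<close>

lemma le_limit_of_scaled_le:
  fixes b c d :: real
  assumes "\<And>t. 0 < t \<Longrightarrow> t < 1 \<Longrightarrow> b + (1 - t) * c \<le> d"
  shows "b + c \<le> d"
proof -
  have "((\<lambda>t. b + (1 - t) * c) \<longlongrightarrow> b + (1 - 0) * c) (at_right 0)"
    by (intro tendsto_intros)
  moreover have "\<forall>\<^sub>F t in at_right 0. b + (1 - t) * c \<le> d"
    using assms eventually_at_right_real[of 0 1] by (auto elim: eventually_mono)
  ultimately show ?thesis
    using tendsto_upperbound[of _ _ "at_right (0::real)" d] by (force simp: trivial_limit_at_right_real)
qed

text \<open>Compare the minimizer \<open>x\<close> with an interior point of the segment to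
  \<open>y\<close>, divide by \<open>t\<close> and let \<open>t\<close> tend to 0. The argument is
  free of derivatives, so it also serves the nonsmooth prox objective and the sum
  \<open>f + g\<close>.\<close>

lemma strongly_convex_minimum_growth:
  fixes f :: "'a::real_inner \<Rightarrow> real"
  assumes sc: "strongly_convex_on S f \<mu>" and x: "x \<in> S" and y: "y \<in> S"
    and min: "\<And>z. z \<in> S \<Longrightarrow> f x \<le> f z"
  shows "f x + \<mu> / 2 * (norm (y - x))\<^sup>2 \<le> f y"
proof (rule le_limit_of_scaled_le)
  fix t :: real assume t: "0 < t" "t < 1"
  have "(1 - t) *\<^sub>R x + t *\<^sub>R y \<in> S"
    using strongly_convex_on_imp_convex[OF sc] x y t by (simp add: convex_alt)
  then have "f x \<le> (1 - t) * f x + t * f y - \<mu> / 2 * t * (1 - t) * (norm (y - x))\<^sup>2"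
    using min strongly_convex_onD[OF sc x y, of t] t by fastforce
  then have "t * (f x + (1 - t) * (\<mu> / 2 * (norm (y - x))\<^sup>2)) \<le> t * f y"
    by (simp add: algebra_simps)
  then show "f x + (1 - t) * (\<mu> / 2 * (norm (y - x))\<^sup>2) \<le> f y"
    using t by simp
qed

lemma GDERIV_segment:
  fixes f :: "'a::real_inner \<Rightarrow> real"
  assumes "GDERIV f (x + t *\<^sub>R v) :> D"
  shows "((\<lambda>t. f (x + t *\<^sub>R v)) has_real_derivative inner D v) (at t)"
proof -
  have "((\<lambda>t. x + t *\<^sub>R v) has_derivative (\<lambda>h. h *\<^sub>R v)) (at t)"
    by (auto intro!: derivative_eq_intros)
  from has_derivative_compose[OF this assms[unfolded gderiv_def]]
  show ?thesis
    by (simp add: has_field_derivative_def inner_commute mult.commute[of _ "inner _ _"])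
qed

text \<open>Strong convexity bounds the difference quotients of \<open>f\<close> on the segment from
  \<open>x\<close> to \<open>y\<close>; their one-sided limit at 0 is the directional
  derivative.\<close>

lemma strongly_convex_first_order:
  fixes f :: "'a::real_inner \<Rightarrow> real"
  assumes sc: "strongly_convex_on S f \<mu>" and x: "x \<in> S" and y: "y \<in> S"
    and D: "GDERIV f x :> D"
  shows "f x + inner D (y - x) + \<mu> / 2 * (norm (y - x))\<^sup>2 \<le> f y"
proof -
  let ?v = "y - x"
  have "((\<lambda>t. f (x + t *\<^sub>R ?v)) has_real_derivative inner D ?v) (at 0)"
    using D by (intro GDERIV_segment) simp
  then have "((\<lambda>t. (f (x + t *\<^sub>R ?v) - f x) / t) \<longlongrightarrow> inner D ?v) (at 0)"
    by (simp add: has_field_derivative_iff)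
  then have "((\<lambda>t. (f (x + t *\<^sub>R ?v) - f x) / t) \<longlongrightarrow> inner D ?v) (at_right 0)"
    by (rule filterlim_mono) (auto simp: at_le)
  moreover have "((\<lambda>t. f y - f x - \<mu> / 2 * (1 - t) * (norm ?v)\<^sup>2)
      \<longlongrightarrow> f y - f x - \<mu> / 2 * (1 - 0) * (norm ?v)\<^sup>2) (at_right 0)"
    by (intro tendsto_intros)
  moreover have "\<forall>\<^sub>F t in at_right 0. (f (x + t *\<^sub>R ?v) - f x) / t
      \<le> f y - f x - \<mu> / 2 * (1 - t) * (norm ?v)\<^sup>2"
    using eventually_at_right_real[OF zero_less_one]
  proof (rule eventually_mono)
    fix t :: real assume t: "t \<in> {0<..<1}"
    have "f (x + t *\<^sub>R ?v) \<le> (1 - t) * f x + t * f y - \<mu> / 2 * t * (1 - t) * (norm ?v)\<^sup>2"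
      using strongly_convex_onD[OF sc x y, of t] t by (simp add: algebra_simps)
    then have "f (x + t *\<^sub>R ?v) - f x \<le> (f y - f x - \<mu> / 2 * (1 - t) * (norm ?v)\<^sup>2) * t"
      by (simp add: algebra_simps)
    then show "(f (x + t *\<^sub>R ?v) - f x) / t \<le> f y - f x - \<mu> / 2 * (1 - t) * (norm ?v)\<^sup>2"
      using t by (simp add: divide_le_eq)
  qed
  ultimately have "inner D ?v \<le> f y - f x - \<mu> / 2 * (1 - 0) * (norm ?v)\<^sup>2"
    by (intro tendsto_le[of "at_right 0"]) (auto simp: trivial_limit_at_right_real)
  then show ?thesis by simp
qed

text \<open>Convexity of \<open>S\<close> keeps the whole segment where the Lipschitz bound holds;
  there the bound and Cauchy-Schwarz control the growth of the directional derivative.\<close>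

lemma descent_lemma:
  fixes f :: "'a::real_inner \<Rightarrow> real"
  assumes "convex S" and lip: "L-lipschitz_on S G"
    and D: "\<And>x. x \<in> S \<Longrightarrow> GDERIV f x :> G x"
    and x: "x \<in> S" and y: "y \<in> S"
  shows "f y \<le> f x + inner (G x) (y - x) + L / 2 * (norm (y - x))\<^sup>2"
proof -
  let ?v = "y - x"
  \<comment> \<open>\<open>\<phi>\<close> is \<open>f\<close> along the segment minus the
    non-constant part of its quadratic upper model, so the claim is exactly
    \<open>\<phi> 1 \<le> \<phi> 0\<close>.\<close>
  define \<phi> where "\<phi> t = f (x + t *\<^sub>R ?v) - t * inner (G x) ?v - L / 2 * t\<^sup>2 * (norm ?v)\<^sup>2" for t
  have "\<phi> 1 \<le> \<phi> 0"
  proof (rule DERIV_nonpos_imp_nonincreasing[of 0 1 \<phi>])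
    fix t :: real assume t: "0 \<le> t" "t \<le> 1"
    have mem: "x + t *\<^sub>R ?v \<in> S"
      using \<open>convex S\<close> x y t by (simp add: convex_alt algebra_simps)
    let ?d = "inner (G (x + t *\<^sub>R ?v)) ?v - inner (G x) ?v - L * t * (norm ?v)\<^sup>2"
    have "(\<phi> has_real_derivative ?d) (at t)"
      unfolding \<phi>_def
      by (rule derivative_eq_intros GDERIV_segment[OF D[OF mem]] refl)+ simp
    moreover have "?d \<le> 0"
    proof -
      have "inner (G (x + t *\<^sub>R ?v) - G x) ?v \<le> norm (G (x + t *\<^sub>R ?v) - G x) * norm ?v"
        by (rule norm_cauchy_schwarz)
      also have "\<dots> \<le> (L * (t * norm ?v)) * norm ?v"
        using lipschitz_onD[OF lip mem x] t by (intro mult_right_mono) (auto simp: dist_norm)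
      finally show ?thesis by (simp add: inner_diff_left power2_eq_square algebra_simps)
    qed
    ultimately show "\<exists>d. (\<phi> has_real_derivative d) (at t) \<and> d \<le> 0" by blast
  qed simp
  then show ?thesis by (simp add: \<phi>_def)
qed

section \<open>Proximal maps\<close>

text \<open>\<open>prox\<close> picks some minimizer by choice, so one must first be shown to exist:
  minimize over a ball that is large enough for points outside to lose against \<open>z\<close>
  itself.\<close>

lemma prox_minimizes:
  fixes h :: "'a::euclidean_space \<Rightarrow> real"
  assumes "continuous_on UNIV h" and "\<And>y. 0 \<le> h y"
  shows "h (prox h z) + 1 / 2 * (norm (prox h z - z))\<^sup>2 \<le> h y + 1 / 2 * (norm (y - z))\<^sup>2"
proof -
  define F where "F y = h y + 1 / 2 * (norm (y - z))\<^sup>2" for y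
  \<comment> \<open>With \<open>r \<ge> 1\<close>, a point at distance at least \<open>r\<close>
    from \<open>z\<close> has squared distance at least \<open>r\<close>, so half of that already
    exceeds \<open>h z\<close>, the value of \<open>F\<close> at \<open>z\<close>.\<close>
  define r where "r = 1 + 2 * h z"
  have r: "1 \<le> r" using assms(2)[of z] by (simp add: r_def)
  have "continuous_on (cball z r) F"
    unfolding F_def by (intro continuous_intros continuous_on_subset[OF assms(1)]) auto
  then obtain p where p: "p \<in> cball z r" "\<And>y. y \<in> cball z r \<Longrightarrow> F p \<le> F y"
    using continuous_attains_inf[of "cball z r" F] r by auto
  have "F p \<le> F y" for y
  proof (cases "y \<in> cball z r")
    case False
    then have "r \<le> norm (y - z)" by (simp add: dist_norm norm_minus_commute)
    then have "r * 1 \<le> norm (y - z) * norm (y - z)" using r by (intro mult_mono) auto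
    then have "F z \<le> F y" using assms(2)[of y] by (simp add: F_def r_def power2_eq_square)
    moreover have "F p \<le> F z" using p(2)[of z] r by simp
    ultimately show ?thesis by simp
  qed (use p in auto)
  then have "is_arg_min F (\<lambda>_. True) p" by (auto simp: is_arg_min_linorder)
  then have "is_arg_min F (\<lambda>_. True) (prox h z)"
    unfolding prox_def arg_min_def F_def by (rule someI)
  then show ?thesis by (simp add: is_arg_min_linorder F_def)
qed

text \<open>The prox objective is \<open>1 / 2 * (norm y)\<^sup>2\<close> plus \<open>h\<close> plus
  an affine function, hence strongly convex with modulus 1; the extra term is its quadratic growth
  around the minimizer.\<close>

lemma prox_inequality:
  fixes h :: "'a::euclidean_space \<Rightarrow> real"
  assumes "convex_on UNIV h" and "\<And>y. 0 \<le> h y"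
  shows "h (prox h z) + 1 / 2 * (norm (prox h z - z))\<^sup>2 + 1 / 2 * (norm (y - prox h z))\<^sup>2
    \<le> h y + 1 / 2 * (norm (y - z))\<^sup>2"
proof -
  have "convex_on UNIV (\<lambda>y. h y + (1 / 2 * inner z z - inner z y))"
    by (intro convex_on_add assms(1))
      (auto simp: convex_on_alt field_simps inner_simps)
  also have "(\<lambda>y. h y + (1 / 2 * inner z z - inner z y))
      = (\<lambda>y. h y + 1 / 2 * (norm (y - z))\<^sup>2 - 1 / 2 * (norm y)\<^sup>2)"
    by (simp add: fun_eq_iff power2_norm_eq_inner inner_simps inner_commute algebra_simps)
  finally have "strongly_convex_on UNIV (\<lambda>y. h y + 1 / 2 * (norm (y - z))\<^sup>2) 1"
    by (simp add: strongly_convex_on_def)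
  moreover have "continuous_on UNIV h"
    using assms(1) by (intro convex_on_continuous) auto
  ultimately show ?thesis
    using strongly_convex_minimum_growth[of UNIV "\<lambda>y. h y + 1 / 2 * (norm (y - z))\<^sup>2" 1 "prox h z" y]
      prox_minimizes[of h, OF _ assms(2)]
    by blast
qed

section \<open>Gradients and their uniqueness\<close>

text \<open>\<open>grad\<close> is a definite description, so it denotes a gradient only because
  gradients are unique.\<close>

lemma GDERIV_grad:
  assumes "GDERIV f x :> D"
  shows "GDERIV f x :> grad f x"
proof -
  have "D' = D" if "GDERIV f x :> D'" for D'
  proof -
    have "(\<lambda>h. inner h D') = (\<lambda>h. inner h D)"
      using that assms unfolding gderiv_def by (rule has_derivative_unique)
    then show ?thesis by (metis vector_eq_ldot)
  qed
  with assms show ?thesis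
    unfolding grad_def by (metis the_equality)
qed

lemma differentiable_imp_GDERIV:
  fixes f :: "'a::euclidean_space \<Rightarrow> real"
  assumes "f differentiable (at x)"
  shows "GDERIV f x :> grad f x"
proof -
  obtain f' where f': "(f has_derivative f') (at x)"
    using assms by (auto simp: differentiable_def)
  then have "linear f'" by (rule has_derivative_linear)
  \<comment> \<open>The Riesz representer of the functional \<open>f'\<close> is its adjoint applied
    to the real number 1.\<close>
  then have "f' = (\<lambda>h. inner h (adjoint f' 1))"
    using adjoint_works[of f' _ 1] by (simp add: fun_eq_iff inner_commute)
  with f' have "GDERIV f x :> adjoint f' 1" unfolding gderiv_def by metis
  then show ?thesis by (rule GDERIV_grad)
qed

text \<open>
  The Lipschitz bound is only available on the sublevel set, so membership of the new iterate is
  obtained by walking along the segment towards it: the sublevel set is convex and closed, and on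
  it the descent lemma keeps \<open>f + g\<close> strictly below the level \<open>a\<close>, so the walk cannot stop early.
\<close>

locale composite_sublevel =
  fixes f g :: "'a::euclidean_space \<Rightarrow> real" and D :: "'a set" and a \<mu> L :: real
  assumes open_D: "open D"
    and differentiable_f: "x \<in> D \<Longrightarrow> f differentiable (at x)"
    and closed_sublevel: "closed {x \<in> D. f x \<le> a}"
    and \<mu>_pos: "0 < \<mu>" and L_pos: "0 < L"
    and strongly_convex_f: "strongly_convex_on {x \<in> D. f x \<le> a} f \<mu>"
    and lipschitz_grad: "L-lipschitz_on {x \<in> D. f x \<le> a} (grad f)"
    and convex_g: "convex_on UNIV g" and g_nonneg: "0 \<le> g x"
begin

abbreviation "S \<equiv> {x \<in> D. f x \<le> a}"

lemma convex_S: "convex S"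
  by (rule strongly_convex_on_imp_convex[OF strongly_convex_f])

lemma GDERIV_f: "x \<in> D \<Longrightarrow> GDERIV f x :> grad f x"
  by (simp add: differentiable_f differentiable_imp_GDERIV)

lemma continuous_f: "continuous_on D f"
  by (meson differentiable_f continuous_at_imp_continuous_on differentiable_imp_continuous_within)

lemma mem_S_of_sum_le: "x \<in> D \<Longrightarrow> f x + g x \<le> a \<Longrightarrow> x \<in> S"
  using g_nonneg[of x] by simp

text \<open>Above its tangent at \<open>x\<close> the function grows quadratically, while the
  tangent itself falls at most linearly; far from \<open>x\<close> the level \<open>a\<close> is
  therefore exceeded.\<close>

lemma bounded_S: "bounded S"
proof (cases "S = {}")
  case True
  then show ?thesis by (simp only: bounded_empty)
next
  case False
  then obtain x where x: "x \<in> S" by blast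
  define G where "G = norm (grad f x)"
  \<comment> \<open>The summand 1 puts every point outside the ball at distance more than 1, so that
    \<open>a - f x\<close> may be multiplied by the distance and one factor of it cancelled.\<close>
  define r where "r = 2 * (a - f x + G) / \<mu> + 1"
  have "norm (y - x) \<le> r" if y: "y \<in> S" for y
  proof (rule ccontr)
    assume "\<not> norm (y - x) \<le> r"
    then have r: "r < norm (y - x)" by simp
    have "0 \<le> a - f x" "0 \<le> G" using x by (auto simp: G_def)
    then have "0 \<le> 2 * (a - f x + G) / \<mu>" using \<mu>_pos by simp
    then have one: "1 \<le> norm (y - x)" using r unfolding r_def by linarith
    have "\<mu> / 2 * (norm (y - x))\<^sup>2 \<le> a - f x - inner (grad f x) (y - x)"
      using strongly_convex_first_order[OF strongly_convex_f x y GDERIV_f] x y by simp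
    also have "\<dots> \<le> (a - f x) * norm (y - x) + G * norm (y - x)"
    proof -
      have "- inner (grad f x) (y - x) \<le> G * norm (y - x)"
        using Cauchy_Schwarz_ineq2[of "grad f x" "y - x"] unfolding G_def by linarith
      moreover have "a - f x \<le> (a - f x) * norm (y - x)"
        using one \<open>0 \<le> a - f x\<close> mult_left_mono[of 1 "norm (y - x)" "a - f x"] by simp
      ultimately show ?thesis by linarith
    qed
    finally have "\<mu> / 2 * norm (y - x) * norm (y - x) \<le> (a - f x + G) * norm (y - x)"
      by (simp add: power2_eq_square algebra_simps)
    then have "\<mu> / 2 * norm (y - x) \<le> a - f x + G"
      by (rule mult_right_le_imp_le) (use one in linarith)
    then have "norm (y - x) \<le> 2 * (a - f x + G) / \<mu>" using \<mu>_pos by (simp add: field_simps)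
    with r show False by (simp add: r_def)
  qed
  then show ?thesis
    by (auto simp: bounded_any_center[of _ x] dist_norm norm_minus_commute)
qed

lemma strongly_convex_sum: "strongly_convex_on S (\<lambda>x. f x + g x) \<mu>"
proof -
  have "convex_on S (\<lambda>x. (f x - \<mu> / 2 * (norm x)\<^sup>2) + g x)"
    using strongly_convex_f convex_on_subset[OF convex_g subset_UNIV convex_S]
    unfolding strongly_convex_on_def by (rule convex_on_add)
  then show ?thesis by (simp add: strongly_convex_on_def algebra_simps)
qed

text \<open>A point of \<open>D\<close> with \<open>f + g\<close> above \<open>a\<close> is worse
  than \<open>x0\<close>, and every other one lies in the compact set \<open>S\<close> because
  \<open>g\<close> is nonnegative. Quadratic growth on \<open>S\<close> then gives
  uniqueness.\<close>

lemma ex_unique_minimizer: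
  assumes x0: "x0 \<in> D" "f x0 + g x0 < a"
  shows "\<exists>!x. is_arg_min (\<lambda>x. f x + g x) (\<lambda>x. x \<in> D) x"
proof -
  let ?F = "\<lambda>x. f x + g x"
  have x0S: "x0 \<in> S" using mem_S_of_sum_le x0 by simp
  have "continuous_on S ?F"
    using convex_g by (intro continuous_on_add continuous_on_subset[OF continuous_f]
        continuous_on_subset[OF convex_on_continuous[of UNIV g]]) auto
  moreover have "compact S" using bounded_S closed_sublevel by (simp add: compact_eq_bounded_closed)
  ultimately obtain x where x: "x \<in> S" and min: "\<And>y. y \<in> S \<Longrightarrow> ?F x \<le> ?F y"
    using continuous_attains_inf[of S ?F] x0S by blast
  have global: "?F x \<le> ?F y" if "y \<in> D" for y
    using that min[of y] min[OF x0S] x0 mem_S_of_sum_le[of y] by (cases "f y + g y \<le> a") auto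
  show ?thesis
  proof
    show "is_arg_min ?F (\<lambda>x. x \<in> D) x"
      using global x by (auto simp: is_arg_min_linorder)
  next
    fix y assume "is_arg_min ?F (\<lambda>x. x \<in> D) y"
    then have y: "y \<in> D" "?F y \<le> ?F x" using x by (auto simp: is_arg_min_linorder)
    then have "y \<in> S" using min[OF x0S] x0 by (intro mem_S_of_sum_le) auto
    then have "?F x + \<mu> / 2 * (norm (y - x))\<^sup>2 \<le> ?F y"
      by (intro strongly_convex_minimum_growth[OF strongly_convex_sum x] min)
    with y have "\<mu> / 2 * (norm (y - x))\<^sup>2 \<le> 0" by linarith
    with \<mu>_pos show "y = x" by (simp add: mult_le_0_iff)
  qed
qed

definition step :: "real \<Rightarrow> 'a \<Rightarrow> 'a" where
  "step \<alpha> x = prox (\<lambda>z. \<alpha> * g z) (x - \<alpha> *\<^sub>R grad f x)"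

text \<open>This is the prox inequality with the squares around
  \<open>x - \<alpha> *\<^sub>R grad f x\<close> expanded around \<open>x\<close>; the square of the
  gradient term cancels.\<close>

lemma step_inequality:
  assumes "0 \<le> \<alpha>"
  shows "\<alpha> * g (step \<alpha> x) + \<alpha> * inner (grad f x) (step \<alpha> x - x) + 1 / 2 * (norm (step \<alpha> x - x))\<^sup>2
      + 1 / 2 * (norm (y - step \<alpha> x))\<^sup>2
    \<le> \<alpha> * g y + \<alpha> * inner (grad f x) (y - x) + 1 / 2 * (norm (y - x))\<^sup>2"
proof -
  have "(norm (u - (x - \<alpha> *\<^sub>R v)))\<^sup>2 = (norm (u - x))\<^sup>2 + 2 * \<alpha> * inner v (u - x) + (norm (\<alpha> *\<^sub>R v))\<^sup>2"
    for u v by (simp only: power2_norm_eq_inner) (simp add: inner_simps inner_commute algebra_simps)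
  note this[of "step \<alpha> x" "grad f x"] this[of y "grad f x"]
  moreover have "\<alpha> * g (step \<alpha> x) + 1 / 2 * (norm (step \<alpha> x - (x - \<alpha> *\<^sub>R grad f x)))\<^sup>2
      + 1 / 2 * (norm (y - step \<alpha> x))\<^sup>2 \<le> \<alpha> * g y + 1 / 2 * (norm (y - (x - \<alpha> *\<^sub>R grad f x)))\<^sup>2"
    unfolding step_def using assms convex_g g_nonneg by (intro prox_inequality convex_on_cmul) auto
  ultimately show ?thesis by linarith
qed

lemma step_zero: "step 0 x = x"
  using step_inequality[of 0 x x] by (simp add: norm_minus_commute)

text \<open>Taking \<open>y = x\<close> in the step inequality makes the two halves of the squared
  step length add up; by \<open>\<alpha> \<le> 1 / L\<close> this pays for the quadratic term of the
  descent lemma. Membership in \<open>S\<close> is assumed here and established afterwards.\<close>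

lemma sum_le_along_step:
  assumes \<alpha>: "0 < \<alpha>" "\<alpha> \<le> 1 / L" and x: "x \<in> S" and t: "0 \<le> t" "t \<le> 1"
    and mem: "x + t *\<^sub>R (step \<alpha> x - x) \<in> S"
  shows "f (x + t *\<^sub>R (step \<alpha> x - x)) + g (x + t *\<^sub>R (step \<alpha> x - x)) \<le> f x + g x"
proof -
  let ?d = "step \<alpha> x - x" and ?G = "grad f x"
  have "\<alpha> * (g (step \<alpha> x) + inner ?G ?d) + (norm ?d)\<^sup>2 \<le> \<alpha> * g x"
    using step_inequality[of \<alpha> x x] \<alpha> by (simp add: norm_minus_commute algebra_simps)
  moreover have "\<alpha> * (L * (norm ?d)\<^sup>2) \<le> 1 * (norm ?d)\<^sup>2"
    using \<alpha> L_pos mult_right_mono[of "\<alpha> * L" 1 "(norm ?d)\<^sup>2"] by (simp add: field_simps)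
  ultimately have "\<alpha> * (g (step \<alpha> x) + inner ?G ?d + L * (norm ?d)\<^sup>2) \<le> \<alpha> * g x"
    by (simp add: algebra_simps)
  then have step: "g (step \<alpha> x) + inner ?G ?d + L * (norm ?d)\<^sup>2 \<le> g x"
    using \<alpha> by simp
  have "f (x + t *\<^sub>R ?d) \<le> f x + t * inner ?G ?d + L / 2 * t * t * (norm ?d)\<^sup>2"
    using descent_lemma[OF convex_S lipschitz_grad GDERIV_f x mem]
    by (simp add: power_mult_distrib power2_eq_square[of t] mult.assoc)
  also have "L / 2 * t * t * (norm ?d)\<^sup>2 \<le> L * t * 1 * (norm ?d)\<^sup>2"
    using t L_pos by (intro mult_right_mono mult_mono) auto
  moreover have "g (x + t *\<^sub>R ?d) \<le> (1 - t) * g x + t * g (step \<alpha> x)"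
    using convex_onD[OF convex_g t, of x "step \<alpha> x"] by (simp add: algebra_simps)
  moreover have "t * (g (step \<alpha> x) + inner ?G ?d + L * (norm ?d)\<^sup>2) \<le> t * g x"
    using t step by (intro mult_left_mono)
  ultimately show ?thesis by (simp add: algebra_simps)
qed

lemma step_mem:
  assumes \<alpha>: "0 < \<alpha>" "\<alpha> \<le> 1 / L" and x: "x \<in> S" "f x + g x < a"
  shows "step \<alpha> x \<in> S"
proof -
  let ?p = "\<lambda>t. x + t *\<^sub>R (step \<alpha> x - x)"
  define T where "T = {t \<in> {0..1}. ?p t \<in> S}"
  have "closed (?p -` S)" by (intro closed_vimage[OF closed_sublevel] continuous_intros)
  moreover have "T = {0..1} \<inter> ?p -` S" by (auto simp: T_def)
  ultimately have "closed T" by (metis closed_Int closed_atLeastAtMost)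
  then have "compact T"
    by (auto simp: T_def compact_eq_bounded_closed intro: bounded_subset[of "{0..1}"])
  moreover have "0 \<in> T" using x by (simp add: T_def)
  \<comment> \<open>\<open>t\<close> is the last parameter at which the segment is in
    \<open>S\<close>.\<close>
  ultimately obtain t where t: "t \<in> T" and max: "\<And>s. s \<in> T \<Longrightarrow> s \<le> t"
    using compact_attains_sup[of T] by blast
  have "t = 1"
  proof (rule ccontr)
    assume "t \<noteq> 1"
    with t have t1: "0 \<le> t" "t < 1" and pt: "?p t \<in> S" by (auto simp: T_def)
    \<comment> \<open>Strictness is the point: since \<open>D\<close> is open and \<open>f\<close>
      continuous, the segment stays below the level a little beyond \<open>t\<close>, contradicting
      maximality.\<close>
    have "f (?p t) < a"
      using sum_le_along_step[OF \<alpha> x(1) _ _ pt] t1 x(2) g_nonneg[of "?p t"] by simp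
    define U where "U = {y \<in> D. f y < a}"
    have "U = D \<inter> f -` {..<a}" by (auto simp: U_def)
    then have "open U" using continuous_open_preimage[OF continuous_f open_D] by simp
    moreover have "continuous_on UNIV ?p" by (intro continuous_intros)
    ultimately have "open (?p -` U)" by (intro open_vimage)
    moreover have "t \<in> ?p -` U" using pt \<open>f (?p t) < a\<close> by (simp add: U_def)
    ultimately obtain e where e: "0 < e" "ball t e \<subseteq> ?p -` U" by (meson open_contains_ball)
    define s where "s = min 1 (t + e / 2)"
    have s: "t < s" "s \<le> 1" "s \<in> ball t e" using e t1 by (auto simp: s_def dist_real_def)
    then have "?p s \<in> U" using e by blast
    then have "s \<in> T" using s t1 by (auto simp: T_def U_def)
    with max[of s] s show False by simp
  qed
  with t show ?thesis by (simp add: T_def)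
qed

lemma step_contracts:
  assumes \<alpha>: "0 < \<alpha>" "\<alpha> \<le> 1 / L" and x: "x \<in> S" "f x + g x < a"
    and min: "is_arg_min (\<lambda>x. f x + g x) (\<lambda>x. x \<in> D) s"
  shows "(norm (step \<alpha> x - s))\<^sup>2 \<le> (1 - \<mu> * \<alpha>) * (norm (x - s))\<^sup>2"
proof -
  let ?p = "step \<alpha> x"
  have p: "?p \<in> S" by (rule step_mem[OF \<alpha> x])
  have sD: "s \<in> D" and smin: "\<And>y. y \<in> D \<Longrightarrow> f s + g s \<le> f y + g y"
    using min by (auto simp: is_arg_min_linorder)
  have s: "s \<in> S" using smin[of x] x sD by (intro mem_S_of_sum_le) auto
  \<comment> \<open>Five inequalities are summed: descent from \<open>x\<close> to
    \<open>?p\<close>, the step size bound, the strong convexity tangent at \<open>x\<close>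
    evaluated at \<open>s\<close>, optimality of \<open>s\<close>, and the step inequality with
    \<open>y = s\<close>. All function values and inner products cancel.\<close>
  have "\<alpha> * f ?p \<le> \<alpha> * (f x + inner (grad f x) (?p - x) + L / 2 * (norm (?p - x))\<^sup>2)"
    using descent_lemma[OF convex_S lipschitz_grad GDERIV_f x(1) p] \<alpha> by (intro mult_left_mono) auto
  moreover have "\<alpha> * (L * (norm (?p - x))\<^sup>2) \<le> 1 * (norm (?p - x))\<^sup>2"
    using \<alpha> L_pos mult_right_mono[of "\<alpha> * L" 1 "(norm (?p - x))\<^sup>2"] by (simp add: field_simps)
  moreover have "\<alpha> * (f x + inner (grad f x) (s - x) + \<mu> / 2 * (norm (s - x))\<^sup>2) \<le> \<alpha> * f s"
    using strongly_convex_first_order[OF strongly_convex_f x(1) s GDERIV_f] x \<alpha>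
    by (intro mult_left_mono) auto
  moreover have "\<alpha> * (f s + g s) \<le> \<alpha> * (f ?p + g ?p)"
    using smin[of ?p] p \<alpha> by (intro mult_left_mono) auto
  moreover note step_inequality[of \<alpha> x s]
  ultimately show ?thesis
    using \<alpha> by (simp add: norm_minus_commute algebra_simps)
qed

lemma iterates_contract:
  assumes \<alpha>: "0 \<le> \<alpha>" "\<alpha> \<le> 1 / L" and x0: "x 0 \<in> D" "f (x 0) + g (x 0) < a"
    and iter: "\<And>k. x (Suc k) = step \<alpha> (x k)"
    and min: "is_arg_min (\<lambda>x. f x + g x) (\<lambda>x. x \<in> D) s"
  shows "x k \<in> D" and "(norm (x (Suc k) - s))\<^sup>2 \<le> (1 - \<mu> * \<alpha>) * (norm (x k - s))\<^sup>2"
proof -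
  \<comment> \<open>The invariant bounds \<open>f + g\<close> strictly, not only \<open>f\<close>:
    \<open>step_mem\<close> consumes the strict bound and \<open>sum_le_along_step\<close> at
    \<open>t = 1\<close> restores it. The case \<open>\<alpha> = 0\<close> is separate because the
    other lemmas divide by \<open>\<alpha>\<close>.\<close>
  have inv: "x k \<in> S \<and> f (x k) + g (x k) < a" for k
  proof (induction k)
    case 0
    then show ?case using x0 mem_S_of_sum_le[of "x 0"] by simp
  next
    case (Suc k)
    show ?case
    proof (cases "\<alpha> = 0")
      case True
      then show ?thesis using Suc by (simp add: iter step_zero)
    next
      case False
      with \<alpha> have "0 < \<alpha>" by simp
      with Suc \<alpha> have "step \<alpha> (x k) \<in> S" by (intro step_mem) auto
      then show ?thesis
        using sum_le_along_step[of \<alpha> "x k" 1] \<open>0 < \<alpha>\<close> \<alpha> Suc by (auto simp: iter)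
    qed
  qed
  then show "x k \<in> D" by blast
  show "(norm (x (Suc k) - s))\<^sup>2 \<le> (1 - \<mu> * \<alpha>) * (norm (x k - s))\<^sup>2"
    using step_contracts[of \<alpha> "x k" s] inv[of k] min \<alpha>
    by (cases "\<alpha> = 0") (auto simp: iter step_zero)
qed

end

subsection \<open>Positive semidefinite matrices\<close>

lemma bounded_bilinear_matrix_mult:
  "bounded_bilinear ((**) :: complex^'n^'m \<Rightarrow> complex^'p^'n \<Rightarrow> complex^'p^'m)"
  unfolding bilinear_conv_bounded_bilinear[symmetric] bilinear_def linear_iff
  by (simp add: matrix_matrix_mult_def vec_eq_iff sum.distrib scaleR_sum_right algebra_simps)

lemma bounded_bilinear_matrix_vector:
  "bounded_bilinear ((*v) :: complex^'n^'m \<Rightarrow> complex^'n \<Rightarrow> complex^'m)"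
  unfolding bilinear_conv_bounded_bilinear[symmetric] bilinear_def linear_iff
  by (simp add: matrix_vector_mult_def vec_eq_iff sum.distrib scaleR_sum_right algebra_simps)

interpretation matrix_mult: bounded_bilinear
  "(**) :: complex^'n^'m \<Rightarrow> complex^'p^'n \<Rightarrow> complex^'p^'m"
  by (rule bounded_bilinear_matrix_mult)

interpretation matrix_vector: bounded_bilinear
  "(*v) :: complex^'n^'m \<Rightarrow> complex^'n \<Rightarrow> complex^'m"
  by (rule bounded_bilinear_matrix_vector)

text \<open>The full complex Hermitian form is kept beside \<open>inner\<close>, its real part,
  because the Cauchy-Schwarz inequality below needs the modulus and the phase.\<close>

definition cdot :: "complex^'n \<Rightarrow> complex^'n \<Rightarrow> complex" where
  "cdot u v = (\<Sum>i\<in>UNIV. cnj (u $ i) * v $ i)"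

lemma cdot_add_left: "cdot (u + v) w = cdot u w + cdot v w"
  and cdot_add_right: "cdot u (v + w) = cdot u v + cdot u w"
  and cdot_smult_left: "cdot (c *s u) v = cnj c * cdot u v"
  and cdot_smult_right: "cdot u (c *s v) = c * cdot u v"
  by (simp_all add: cdot_def sum.distrib sum_distrib_left algebra_simps)

lemma cdot_cnj: "cnj (cdot u v) = cdot v u"
  by (simp add: cdot_def mult.commute)

lemma Re_cdot: "Re (cdot u v) = inner u v"
  by (simp add: cdot_def inner_vec_def inner_complex_def)

lemma cdot_axis_left: "cdot (axis i 1) v = v $ i"
proof -
  have "cnj (axis i 1 $ j) * v $ j = (if j = i then v $ j else 0)" for j
    by (simp add: axis_def)
  then show ?thesis by (simp add: cdot_def)
qed

lemma matrix_vector_axis: "(M *v axis j 1) $ i = (M $ i $ j :: complex)"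
  by (simp add: matrix_vector_mult_def axis_def if_distrib cong: if_cong)

lemma ctranspose_ctranspose [simp]: "ctranspose (ctranspose M) = M"
  by (simp add: ctranspose_def vec_eq_iff)

lemma ctranspose_mult: "ctranspose (M ** N) = ctranspose N ** ctranspose M"
  by (simp add: ctranspose_def matrix_matrix_mult_def vec_eq_iff mult.commute)

lemma ctranspose_add: "ctranspose (M + N) = ctranspose M + ctranspose N"
  and ctranspose_diff: "ctranspose (M - N) = ctranspose M - ctranspose N"
  and ctranspose_scaleR: "ctranspose (c *\<^sub>R M) = c *\<^sub>R ctranspose M"
  by (simp_all add: ctranspose_def vec_eq_iff)

lemma ctranspose_mat_1 [simp]: "ctranspose (mat 1) = mat 1"
  by (auto simp: ctranspose_def mat_def vec_eq_iff)

lemma cdot_matrix: "cdot u (M *v v) = cdot (ctranspose M *v u) v"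
proof -
  have "cdot u (M *v v) = (\<Sum>i\<in>UNIV. \<Sum>j\<in>UNIV. cnj (u $ i) * (M $ i $ j * v $ j))"
    by (simp add: cdot_def matrix_vector_mult_def sum_distrib_left)
  also have "\<dots> = (\<Sum>j\<in>UNIV. \<Sum>i\<in>UNIV. cnj (u $ i) * (M $ i $ j * v $ j))"
    by (rule sum.swap)
  also have "\<dots> = cdot (ctranspose M *v u) v"
    by (simp add: cdot_def matrix_vector_mult_def ctranspose_def sum_distrib_left mult_ac)
  finally show ?thesis .
qed

lemma inner_matrix: "inner u (M *v v) = inner (ctranspose M *v u) (v :: complex^'n)"
  using arg_cong[OF cdot_matrix, of Re] by (simp only: Re_cdot)

lemma matrix_vector_scaleR:
  fixes M :: "complex^'n^'m"
  shows "M *v (c *\<^sub>R v) = c *\<^sub>R (M *v v)" and "(c *\<^sub>R M) *v v = c *\<^sub>R (M *v v)"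
  by (simp_all add: vec_eq_iff matrix_vector_mult_def scaleR_sum_right)

section \<open>Semidefinite forms, rank-one deflation and traces\<close>

definition psd :: "complex^'n^'n \<Rightarrow> bool" where
  "psd M \<longleftrightarrow> ctranspose M = M \<and> (\<forall>v. 0 \<le> inner v (M *v v))"

lemma pos_def_iff:
  "pos_def M \<longleftrightarrow> ctranspose M = M \<and> (\<forall>v. v \<noteq> 0 \<longrightarrow> 0 < inner v (M *v v))"
  unfolding pos_def_def by (simp add: cdot_def flip: Re_cdot)

lemma pos_def_imp_psd: "pos_def M \<Longrightarrow> psd M"
  unfolding pos_def_iff psd_def by (metis inner_zero_left order_le_less)

lemma hermitian_cdot_self:
  assumes "ctranspose M = M"
  shows "cdot v (M *v v) = of_real (inner v (M *v v))"
proof -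
  have "cnj (cdot v (M *v v)) = cdot v (M *v v)"
    using assms by (metis cdot_cnj cdot_matrix)
  then show ?thesis by (metis Re_cdot of_real_Re Reals_cnj_iff)
qed

lemma psd_Cauchy_Schwarz:
  assumes "psd M"
  shows "(cmod (cdot u (M *v v)))\<^sup>2 \<le> inner u (M *v u) * inner v (M *v v)"
proof -
  define a b c where "a = inner u (M *v u)" and "b = inner v (M *v v)" and "c = cdot u (M *v v)"
  have herm: "ctranspose M = M" using assms by (simp add: psd_def)
  have vu: "cdot v (M *v u) = cnj c" using herm by (metis c_def cdot_cnj cdot_matrix)
  have quad: "0 \<le> a - 2 * s * (cmod c)\<^sup>2 + s\<^sup>2 * (cmod c)\<^sup>2 * b" for s
  proof -
    \<comment> \<open>This phase makes both cross terms equal to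
      \<open>- s * (cmod c)\<^sup>2\<close>, so the form becomes a real quadratic in
      \<open>s\<close>.\<close>
    define z where "z = - of_real s * cnj c"
    have "cdot (u + z *s v) (M *v (u + z *s v))
        = of_real a + z * c + cnj z * cnj c + cnj z * z * of_real b"
      using vu hermitian_cdot_self[OF herm, of u] hermitian_cdot_self[OF herm, of v]
      by (simp add: a_def b_def c_def cdot_add_left cdot_add_right cdot_smult_left cdot_smult_right
          matrix_vector_right_distrib vector_scalar_commute algebra_simps)
    also have "\<dots> = of_real a - 2 * of_real s * (c * cnj c) + (of_real s)\<^sup>2 * (c * cnj c) * of_real b"
      by (simp add: z_def power2_eq_square algebra_simps)
    also have "\<dots> = of_real (a - 2 * s * (cmod c)\<^sup>2 + s\<^sup>2 * (cmod c)\<^sup>2 * b)"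
      by (simp flip: complex_norm_square)
    finally have "inner (u + z *s v) (M *v (u + z *s v))
        = a - 2 * s * (cmod c)\<^sup>2 + s\<^sup>2 * (cmod c)\<^sup>2 * b"
      by (metis Re_cdot Re_complex_of_real)
    then show ?thesis using assms unfolding psd_def by metis
  qed
  have "0 \<le> b" using assms by (simp add: psd_def b_def)
  have "(cmod c)\<^sup>2 \<le> a * b"
  proof (cases "b = 0")
    case True
    have "(cmod c)\<^sup>2 = 0"
    proof (rule ccontr)
      assume "(cmod c)\<^sup>2 \<noteq> 0"
      then show False
        \<comment> \<open>With \<open>b = 0\<close> the quadratic is affine in \<open>s\<close> and
          takes the value -1 at this point.\<close>
        using quad[of "(a + 1) / (2 * (cmod c)\<^sup>2)"] quad[of 0] True by (simp add: field_simps)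
    qed
    with True show ?thesis by simp
  next
    case False
    with \<open>0 \<le> b\<close> have b: "0 < b" by simp
    have "0 \<le> a - (cmod c)\<^sup>2 / b"
      \<comment> \<open>\<open>1 / b\<close> minimizes the quadratic.\<close>
      using quad[of "1 / b"] b by (simp add: field_simps power2_eq_square)
    with b show ?thesis by (simp add: field_simps)
  qed
  then show ?thesis by (simp add: a_def b_def c_def)
qed

definition rank_one :: "complex^'n \<Rightarrow> complex^'n^'n" where
  "rank_one u = (\<chi> i j. u $ i * cnj (u $ j))"

lemma rank_one_vec: "rank_one u *v v = cdot u v *s u"
  by (simp add: rank_one_def matrix_vector_mult_def cdot_def vec_eq_iff sum_distrib_left mult_ac)

lemma inner_rank_one: "inner v (rank_one u *v v) = (cmod (cdot u v))\<^sup>2"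
proof -
  have "cdot v (rank_one u *v v) = cdot u v * cnj (cdot u v)"
    by (simp add: rank_one_vec cdot_smult_right cdot_cnj)
  then show ?thesis
    by (metis Re_cdot Re_complex_of_real complex_norm_square)
qed

lemma ctranspose_rank_one: "ctranspose (rank_one u) = rank_one u"
  by (simp add: rank_one_def ctranspose_def vec_eq_iff mult.commute)

lemma trace_mult_rank_one: "trace (N ** rank_one u) = cdot u (N *v u)"
  by (simp add: trace_def matrix_matrix_mult_def rank_one_def cdot_def matrix_vector_mult_def
      sum_distrib_left mult_ac)

text \<open>Nonnegativity of the deflated form is precisely the Cauchy-Schwarz inequality for the
  form of \<open>M\<close>.\<close>

lemma psd_deflate:
  assumes M: "psd M" and b: "0 < inner u (M *v u)"
  shows "psd (M - (1 / inner u (M *v u)) *\<^sub>R rank_one (M *v u))"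
  unfolding psd_def
proof (intro conjI allI)
  have herm: "ctranspose M = M" using M by (simp add: psd_def)
  then show "ctranspose (M - (1 / inner u (M *v u)) *\<^sub>R rank_one (M *v u))
      = M - (1 / inner u (M *v u)) *\<^sub>R rank_one (M *v u)"
    by (simp add: ctranspose_diff ctranspose_scaleR ctranspose_rank_one)
  fix v
  have "cdot (M *v u) v = cdot u (M *v v)" using herm by (metis cdot_matrix)
  then have "(cmod (cdot (M *v u) v))\<^sup>2 \<le> inner u (M *v u) * inner v (M *v v)"
    using psd_Cauchy_Schwarz[OF M, of u v] by simp
  then have "(cmod (cdot (M *v u) v))\<^sup>2 / inner u (M *v u) \<le> inner v (M *v v)"
    using b by (simp add: divide_le_eq mult.commute)
  then show "0 \<le> inner v ((M - (1 / inner u (M *v u)) *\<^sub>R rank_one (M *v u)) *v v)"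
    by (simp add: matrix_vector_mult_diff_rdistrib matrix_vector_scaleR inner_diff_right
        inner_rank_one)
qed

lemma trace_mult_deflate:
  fixes N M :: "complex^'n^'n"
  shows "Re (trace (N ** (M - c *\<^sub>R rank_one u))) = Re (trace (N ** M)) - c * inner u (N *v u)"
proof -
  have "N ** M = N ** (M - c *\<^sub>R rank_one u) + c *\<^sub>R (N ** rank_one u)"
    by (simp add: matrix_mult.diff_right matrix_mult.scaleR_right)
  moreover have "trace (c *\<^sub>R K) = c *\<^sub>R trace K" for K :: "complex^'n^'n"
    by (simp add: trace_def scaleR_sum_right)
  ultimately show ?thesis by (simp add: trace_add trace_mult_rank_one Re_cdot)
qed

lemma psd_diagonal: "psd M \<Longrightarrow> M $ i $ i = of_real (inner (axis i 1) (M *v axis i 1))"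
  using hermitian_cdot_self[of M "axis i 1"] by (simp add: psd_def cdot_axis_left matrix_vector_axis)

lemma psd_entry_zero:
  assumes "psd M" "M $ i $ i = 0"
  shows "M $ i $ j = 0" "M $ j $ i = 0"
proof -
  have 0: "inner (axis i 1) (M *v axis i 1) = 0"
    using psd_diagonal[OF assms(1), of i] assms(2) by simp
  show "M $ i $ j = 0"
    using psd_Cauchy_Schwarz[OF assms(1), of "axis i 1" "axis j 1"] 0
    by (simp add: cdot_axis_left matrix_vector_axis)
  show "M $ j $ i = 0"
    using psd_Cauchy_Schwarz[OF assms(1), of "axis j 1" "axis i 1"] 0
    by (simp add: cdot_axis_left matrix_vector_axis)
qed

text \<open>Symmetric Gaussian elimination: each step splits off a rank-one term and clears a diagonal entry.\<close>

lemma trace_psd_mult_nonneg: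
  fixes N M :: "complex^'n^'n"
  assumes "psd N" "psd M"
  shows "0 \<le> Re (trace (N ** M))"
  using assms(2)
proof (induction "card {i. M $ i $ i \<noteq> 0}" arbitrary: M rule: less_induct)
  case less
  show ?case
  proof (cases "\<exists>i. M $ i $ i \<noteq> 0")
    case False
    then have "M = 0" using psd_entry_zero(1)[OF less.prems] by (simp add: vec_eq_iff)
    then show ?thesis by (simp add: trace_def)
  next
    case True
    then obtain i where i: "M $ i $ i \<noteq> 0" by blast
    define e :: "complex^'n" where "e = axis i 1"
    define b where "b = inner e (M *v e)"
    define M' where "M' = M - (1 / b) *\<^sub>R rank_one (M *v e)"
    have Mii: "M $ i $ i = of_real b" using psd_diagonal[OF less.prems] by (simp add: b_def e_def)
    moreover have "0 \<le> b" using less.prems by (simp add: b_def psd_def)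
    ultimately have b: "0 < b" using i by (cases "b = 0") auto
    have psd': "psd M'" unfolding M'_def b_def by (rule psd_deflate[OF less.prems b[unfolded b_def]])
    have entry: "M' $ j $ j = M $ j $ j - (1 / b) *\<^sub>R (M $ j $ i * cnj (M $ j $ i))" for j
      by (simp add: M'_def rank_one_def e_def matrix_vector_axis)
    have "M' $ i $ i = 0" using b by (simp add: entry Mii scaleR_conv_of_real)
    \<comment> \<open>A vanishing diagonal entry of \<open>M\<close> kills its whole row, so the
      deflation leaves it zero; with entry \<open>i\<close> cleared, the number of nonzero diagonal
      entries drops.\<close>
    moreover have "M' $ j $ j = 0" if "M $ j $ j = 0" for j
      using psd_entry_zero(1)[OF less.prems that, of i] that by (simp add: entry)
    ultimately have "{j. M' $ j $ j \<noteq> 0} \<subset> {j. M $ j $ j \<noteq> 0}" using i by blast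
    then have "0 \<le> Re (trace (N ** M'))"
      by (intro less.hyps psd' psubset_card_mono) auto
    moreover have "0 \<le> (1 / b) * inner (M *v e) (N *v (M *v e))"
      using b assms(1) by (simp add: psd_def)
    ultimately show ?thesis
      using trace_mult_deflate[of N M "1 / b" "M *v e"] by (simp add: M'_def)
  qed
qed

lemma pos_def_invertible: "pos_def M \<Longrightarrow> invertible M"
  unfolding invertible_left_inverse matrix_left_invertible_ker pos_def_iff
  by (metis inner_zero_right less_irrefl)

lemma matrix_inv_left: "invertible M \<Longrightarrow> matrix_inv M ** M = mat 1"
  and matrix_inv_right: "invertible M \<Longrightarrow> M ** matrix_inv M = mat 1"
  unfolding invertible_def matrix_inv_def by (metis (mono_tags, lifting) someI_ex)+

lemma psd_matrix_inv:
  assumes "pos_def M"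
  shows "psd (matrix_inv M)"
proof -
  let ?P = "matrix_inv M"
  have herm: "ctranspose M = M" using assms by (simp add: pos_def_iff)
  note inv = matrix_inv_left[OF pos_def_invertible[OF assms]]
    matrix_inv_right[OF pos_def_invertible[OF assms]]
  have "ctranspose ?P ** M = mat 1"
    using arg_cong[OF inv(2), of ctranspose] herm by (simp add: ctranspose_mult)
  then have hermP: "ctranspose ?P = ?P"
    using inv(2) by (metis matrix_mul_assoc matrix_mul_lid matrix_mul_rid)
  have "inner v (?P *v v) = inner (?P *v v) (M *v (?P *v v))" for v
    using inv(2) by (simp add: matrix_vector_mul_assoc inner_commute)
  then show ?thesis
    using pos_def_imp_psd[OF assms] hermP by (simp add: psd_def)
qed

text \<open>Deflating the inverse of \<open>X\<close> along \<open>X *v v\<close> shows that it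
  dominates \<open>rank_one v\<close> divided by \<open>inner v (X *v v)\<close>; pairing the
  difference with \<open>N\<close> under the trace gives the bound.\<close>

lemma inner_le_trace_mult_inverse:
  assumes N: "psd N" and X: "pos_def X"
  shows "inner v (N *v v) \<le> Re (trace (N ** matrix_inv X)) * inner v (X *v v)"
proof (cases "v = 0")
  case False
  let ?P = "matrix_inv X"
  define b where "b = inner v (X *v v)"
  have b: "0 < b" using X False by (simp add: pos_def_iff b_def)
  have Pu: "?P *v (X *v v) = v"
    using matrix_inv_left[OF pos_def_invertible[OF X]] by (simp add: matrix_vector_mul_assoc)
  have "psd (?P - (1 / b) *\<^sub>R rank_one v)"
    using psd_deflate[OF psd_matrix_inv[OF X], of "X *v v"] b
    by (simp add: Pu b_def inner_commute)
  from trace_psd_mult_nonneg[OF N this]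
  have "inner v (N *v v) / b \<le> Re (trace (N ** ?P))"
    by (simp add: trace_mult_deflate)
  then show ?thesis using b by (simp add: b_def divide_le_eq)
qed simp

subsection \<open>The Lyapunov equation and the cost\<close>

lemma open_invertible: "open {M :: complex^'n^'n. invertible M}"
proof -
  have "continuous_on UNIV (det :: complex^'n^'n \<Rightarrow> complex)"
    unfolding det_def by (intro continuous_intros)
  then have "open ((det :: complex^'n^'n \<Rightarrow> complex) -` (- {0}))"
    by (intro open_vimage) auto
  then show ?thesis by (simp add: vimage_def invertible_det_nz)
qed

lemma matrix_inv_diff:
  fixes M N :: "complex^'n^'n"
  assumes "invertible M" "invertible N"
  shows "matrix_inv N - matrix_inv M = - (matrix_inv M ** (N - M) ** matrix_inv N)"
  using matrix_inv_left[OF assms(1)] matrix_inv_right[OF assms(2)]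
  by (simp add: matrix_mult.diff_left matrix_mult.diff_right flip: matrix_mul_assoc)

text \<open>Using the resolvent identity \<open>matrix_inv_diff\<close> twice makes the remainder
  quadratic in \<open>N - M\<close>, once the inverse of \<open>N\<close> is bounded near
  \<open>M\<close>.\<close>

lemma has_derivative_matrix_inv:
  fixes M :: "complex^'n^'n"
  assumes M: "invertible M"
  shows "(matrix_inv has_derivative (\<lambda>H. - (matrix_inv M ** H ** matrix_inv M))) (at M)"
proof -
  let ?P = "matrix_inv M"
  obtain K where K: "0 < K" and norm_mult: "\<And>(U :: complex^'n^'n) (W :: complex^'n^'n). norm (U ** W) \<le> norm U * norm W * K"
    using matrix_mult.pos_bounded by blast
  obtain d where d: "0 < d" "\<And>N. dist N M < d \<Longrightarrow> invertible N"
    using open_invertible[unfolded open_dist] M by auto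
  \<comment> \<open>The bound \<open>d\<close> keeps \<open>N\<close> invertible. The other one
    gives \<open>norm ?P * norm ?E * K * K \<le> 1 / 2\<close>, which lets half of
    \<open>norm ?PN\<close> be absorbed on the left below.\<close>
  define e where "e = min d (1 / (2 * K * K * (norm ?P + 1)))"
  show ?thesis
  proof (rule has_derivativeI_sandwich)
    have "0 \<le> norm ?P" by simp
    then have "0 < norm ?P + 1" by linarith
    then show "0 < e" using d K by (simp add: e_def)
    show "bounded_linear (\<lambda>H. - (?P ** H ** ?P))"
      by (intro bounded_linear_minus bounded_linear_compose[OF matrix_mult.bounded_linear_left]
          matrix_mult.bounded_linear_right)
    define C where "C = 2 * K^4 * (norm ?P)^3"
    show "((\<lambda>N. C * norm (N - M)) \<longlongrightarrow> 0) (at M)"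
      by (auto intro!: tendsto_eq_intros)
    fix N assume "N \<noteq> M" and N: "dist N M < e"
    let ?E = "N - M" and ?PN = "matrix_inv N"
    have invN: "invertible N" using N d by (simp add: e_def)
    have mult2: "norm (?P ** ?E ** U) \<le> norm ?P * norm ?E * K * norm U * K"
      for U :: "complex^'n^'n"
    proof -
      have "norm (?P ** ?E ** U) \<le> norm (?P ** ?E) * norm U * K" by (rule norm_mult)
      also have "\<dots> \<le> norm ?P * norm ?E * K * norm U * K"
        using K norm_mult[of ?P ?E] by (intro mult_right_mono) auto
      finally show ?thesis .
    qed
    have small: "norm ?P * norm ?E * K * K \<le> 1 / 2"
    proof -
      have "norm ?E \<le> 1 / (2 * K * K * (norm ?P + 1))" using N by (simp add: e_def dist_norm)
      then have "norm ?E * (2 * K * K * (norm ?P + 1)) \<le> 1"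
        using K \<open>0 < norm ?P + 1\<close> by (simp add: pos_le_divide_eq)
      moreover have "0 \<le> norm ?E * (2 * K * K)" using K by simp
      ultimately show ?thesis by (simp add: algebra_simps)
    qed
    have "norm ?PN \<le> norm ?P + norm ?P * norm ?E * K * norm ?PN * K"
    proof -
      have "?PN = ?P - ?P ** ?E ** ?PN"
        using matrix_inv_diff[OF M invN] by (simp add: algebra_simps)
      then have "norm ?PN \<le> norm ?P + norm (?P ** ?E ** ?PN)"
        by (metis norm_triangle_ineq4)
      with mult2[of ?PN] show ?thesis by linarith
    qed
    also have "\<dots> \<le> norm ?P + 1 / 2 * norm ?PN"
      using mult_right_mono[OF small, of "norm ?PN"] by (simp add: algebra_simps)
    finally have PN: "norm ?PN \<le> 2 * norm ?P" by simp
    have "?PN - ?P - - (?P ** ?E ** ?P) = ?P ** ?E ** (?P - ?PN)"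
      using matrix_inv_diff[OF M invN] by (simp add: matrix_mult.diff_right)
    also have "?P - ?PN = ?P ** ?E ** ?PN"
      using matrix_inv_diff[OF M invN] by (metis minus_diff_eq minus_minus)
    finally have "norm (?PN - ?P - - (?P ** ?E ** ?P))
        \<le> norm ?P * norm ?E * K * norm (?P ** ?E ** ?PN) * K"
      using mult2 by metis
    also have "\<dots> \<le> norm ?P * norm ?E * K * (norm ?P * norm ?E * K * (2 * norm ?P) * K) * K"
      using K PN by (intro mult_right_mono mult_left_mono order_trans[OF mult2]) auto
    also have "\<dots> = C * norm ?E * norm ?E"
      by (simp add: C_def power4_eq_xxxx power3_eq_cube)
    finally show "norm (?PN - ?P - - (?P ** ?E ** ?P)) / norm ?E \<le> C * norm ?E"
      using \<open>N \<noteq> M\<close> by (simp add: divide_le_eq)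
  qed
qed

lemma differentiable_matrix_mult:
  fixes f :: "'a::real_normed_vector \<Rightarrow> complex^'n^'m" and g :: "'a \<Rightarrow> complex^'p^'n"
  assumes "f differentiable (at x within S)" "g differentiable (at x within S)"
  shows "(\<lambda>x. f x ** g x) differentiable (at x within S)"
  using assms unfolding differentiable_def by (blast intro: matrix_mult.FDERIV)

section \<open>Openness of positive definiteness\<close>

text \<open>The constant is the minimum of the form on the compact unit sphere; homogeneity does the
  rest.\<close>

lemma pos_def_lower_bound:
  fixes M :: "complex^'n^'n"
  assumes "pos_def M"
  obtains c where "0 < c" "\<And>v. c * (norm v)\<^sup>2 \<le> inner v (M *v v)"
proof -
  have "continuous_on (sphere 0 1) (\<lambda>v. inner v (M *v v))"
    by (intro continuous_intros matrix_vector.continuous_on)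
  moreover have "axis undefined 1 \<in> sphere (0 :: complex^'n) 1"
    by simp
  ultimately obtain u where u: "u \<in> sphere 0 1"
    and min: "\<And>v. v \<in> sphere 0 1 \<Longrightarrow> inner u (M *v u) \<le> inner v (M *v v)"
    using continuous_attains_inf[of "sphere 0 1" "\<lambda>v. inner v (M *v v)"] by force
  show ?thesis
  proof
    have "u \<noteq> 0" using u by auto
    then show "0 < inner u (M *v u)" using assms by (simp add: pos_def_iff)
    fix v :: "complex^'n"
    show "inner u (M *v u) * (norm v)\<^sup>2 \<le> inner v (M *v v)"
    proof (cases "v = 0")
      case False
      then have "inner u (M *v u) \<le> inner (v /\<^sub>R norm v) (M *v (v /\<^sub>R norm v))"
        by (intro min) simp
      also have "\<dots> = inner v (M *v v) / (norm v)\<^sup>2"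
        by (simp add: matrix_vector_scaleR power2_eq_square divide_inverse mult_ac)
      finally show ?thesis using False by (simp add: pos_le_divide_eq)
    qed simp
  qed
qed

text \<open>Positive definiteness is open only among Hermitian matrices. That suffices, as all
  values of \<open>X_of\<close> are Hermitian for Hermitian \<open>V\<close>.\<close>

lemma pos_def_neighbourhood:
  fixes M :: "complex^'n^'n"
  assumes "pos_def M"
  shows "\<exists>e>0. \<forall>N. ctranspose N = N \<longrightarrow> dist N M < e \<longrightarrow> pos_def N"
proof -
  obtain c where c: "0 < c" "\<And>v. c * (norm v)\<^sup>2 \<le> inner v (M *v v)"
    using pos_def_lower_bound[OF assms] by blast
  obtain K where K: "0 < K" and norm_mult: "\<And>(U :: complex^'n^'n) v. norm (U *v v) \<le> norm U * norm v * K"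
    using matrix_vector.pos_bounded by blast
  have "pos_def N" if herm: "ctranspose N = N" and N: "dist N M < c / K" for N
  proof -
    have "0 < inner v (N *v v)" if "v \<noteq> 0" for v
    proof -
      have "- inner v ((N - M) *v v) \<le> norm v * norm ((N - M) *v v)"
        using Cauchy_Schwarz_ineq2[of v "(N - M) *v v"] by linarith
      also have "\<dots> \<le> norm v * (norm (N - M) * norm v * K)"
        by (intro mult_left_mono norm_mult) simp
      also have "\<dots> = (norm (N - M) * K) * (norm v)\<^sup>2" by (simp add: power2_eq_square)
      also have "\<dots> < c * (norm v)\<^sup>2"
        using N K that by (intro mult_strict_right_mono) (auto simp: dist_norm pos_less_divide_eq)
      also have "\<dots> \<le> inner v (M *v v)" by (rule c)
      finally show ?thesis by (simp add: matrix_vector_mult_diff_rdistrib inner_diff_right)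
    qed
    then show ?thesis using herm by (simp add: pos_def_iff)
  qed
  moreover have "0 < c / K" using c K by simp
  ultimately show ?thesis by blast
qed

section \<open>The Lyapunov solution, its domain and the closed sublevel sets\<close>

lemma linear_ctranspose: "linear (ctranspose :: complex^'n^'m \<Rightarrow> complex^'m^'n)"
  by (simp add: linear_iff ctranspose_add ctranspose_scaleR)

lemma linear_lyap_op: "linear (lyap_op A)"
  by (simp add: linear_iff lyap_op_def matrix_mult.add_left matrix_mult.add_right
      matrix_mult.scaleR_left matrix_mult.scaleR_right algebra_simps)

lemma linear_input_op: "linear (input_op B)"
  by (simp add: linear_iff input_op_def ctranspose_add ctranspose_scaleR matrix_mult.add_left
      matrix_mult.add_right matrix_mult.scaleR_left matrix_mult.scaleR_right algebra_simps)

lemma linear_inv: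
  assumes "linear f" "bij f"
  shows "linear (inv f)"
proof (rule linearI)
  note surj = bij_is_surj[OF assms(2)] and inj = bij_is_inj[OF assms(2)]
  show "inv f (x + y) = inv f x + inv f y" for x y
    by (rule inv_f_eq[OF inj]) (simp add: linear_add[OF assms(1)] surj_f_inv_f[OF surj])
  show "inv f (c *\<^sub>R x) = c *\<^sub>R inv f x" for c x
    by (rule inv_f_eq[OF inj]) (simp add: linear_scale[OF assms(1)] surj_f_inv_f[OF surj])
qed

lemma lyap_op_X_of:
  "bij (lyap_op A) \<Longrightarrow> lyap_op A (X_of A B V Y) = input_op B Y - V"
  unfolding X_of_def by (simp add: bij_is_surj surj_f_inv_f)

text \<open>The conjugate transpose solves the same Lyapunov equation, whose solution is
  unique.\<close>

lemma ctranspose_X_of: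
  assumes bij: "bij (lyap_op A)" and V: "ctranspose V = V"
  shows "ctranspose (X_of A B V Y) = X_of A B V Y"
proof -
  have "lyap_op A (ctranspose (X_of A B V Y)) = ctranspose (lyap_op A (X_of A B V Y))"
    by (simp add: lyap_op_def ctranspose_add ctranspose_mult add.commute)
  also have "\<dots> = lyap_op A (X_of A B V Y)"
    using V by (simp add: lyap_op_X_of[OF bij] input_op_def ctranspose_diff ctranspose_add
        ctranspose_mult add.commute)
  finally show ?thesis using bij_is_inj[OF bij] by (simp add: inj_eq)
qed

lemma X_of_affine:
  assumes "bij (lyap_op A)"
  shows "X_of A B V Y = (inv (lyap_op A) \<circ> input_op B) Y - inv (lyap_op A) V"
  unfolding X_of_def using linear_diff[OF linear_inv[OF linear_lyap_op assms]] by simp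

lemma differentiable_X_of:
  assumes "bij (lyap_op A)"
  shows "X_of A B V differentiable (at Y)"
proof -
  have "linear (inv (lyap_op A) \<circ> input_op B)"
    by (intro linear_compose linear_input_op linear_inv linear_lyap_op assms)
  then have "(\<lambda>Y. (inv (lyap_op A) \<circ> input_op B) Y - inv (lyap_op A) V) differentiable (at Y)"
    by (intro differentiable_diff differentiable_const linear_imp_differentiable)
  then show ?thesis by (simp add: X_of_affine[OF assms, abs_def] o_def)
qed

lemma linear_Re_trace: "linear (\<lambda>K :: complex^'n^'n. Re (trace K))"
  by (simp add: linear_iff trace_def sum.distrib sum_distrib_left)

lemma differentiable_cost:
  assumes bij: "bij (lyap_op A)" and Y: "Y \<in> stab_dom A B V"
  shows "cost A B V Q R differentiable (at Y)"
proof -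
  have "invertible (X_of A B V Y)" using Y by (simp add: stab_dom_def pos_def_invertible)
  then have "matrix_inv differentiable (at (X_of A B V Y))"
    unfolding differentiable_def by (blast intro: has_derivative_matrix_inv)
  from differentiable_chain_at[OF differentiable_X_of[OF bij] this]
  have "(\<lambda>Y. matrix_inv (X_of A B V Y)) differentiable (at Y)"
    by (simp add: o_def)
  then have "(\<lambda>Y. Q ** X_of A B V Y + ctranspose Y ** R ** Y ** matrix_inv (X_of A B V Y))
      differentiable (at Y)"
    by (intro differentiable_add differentiable_matrix_mult differentiable_X_of[OF bij]
        linear_imp_differentiable[OF linear_ctranspose] differentiable_const differentiable_ident)
  from differentiable_chain_at[OF this linear_imp_differentiable[OF linear_Re_trace]]
  show ?thesis by (simp add: cost_def[abs_def] o_def)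
qed

lemma open_stab_dom:
  assumes bij: "bij (lyap_op A)" and V: "ctranspose V = V"
  shows "open (stab_dom A B V)"
  unfolding open_dist
proof
  fix Y assume "Y \<in> stab_dom A B V"
  then obtain e where e: "0 < e"
    "\<And>N. ctranspose N = N \<Longrightarrow> dist N (X_of A B V Y) < e \<Longrightarrow> pos_def N"
    using pos_def_neighbourhood[of "X_of A B V Y"] unfolding stab_dom_def by blast
  have "continuous (at Y) (X_of A B V)"
    by (intro differentiable_imp_continuous_within differentiable_X_of bij)
  then obtain d where "0 < d" "\<And>Z. dist Z Y < d \<Longrightarrow> dist (X_of A B V Z) (X_of A B V Y) < e"
    using e(1) unfolding continuous_at_eps_delta dist_norm by blast
  then show "\<exists>d>0. \<forall>Z. dist Z Y < d \<longrightarrow> Z \<in> stab_dom A B V"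
    using e(2) ctranspose_X_of[OF bij V] unfolding stab_dom_def mem_Collect_eq by blast
qed

lemma psd_congruence:
  assumes "psd R"
  shows "psd (ctranspose Y ** R ** Y)"
  unfolding psd_def
proof (intro conjI allI)
  show "ctranspose (ctranspose Y ** R ** Y) = ctranspose Y ** R ** Y"
    using assms by (simp add: psd_def ctranspose_mult matrix_mul_assoc)
  show "0 \<le> inner v (ctranspose Y ** R ** Y *v v)" for v
    using assms by (simp add: psd_def inner_matrix[of v "ctranspose Y"] flip: matrix_vector_mul_assoc)
qed

text \<open>Cauchy-Schwarz against the vector \<open>M *v v\<close> itself.\<close>

lemma psd_kernel:
  assumes "psd M" "inner v (M *v v) = 0"
  shows "M *v v = 0"
proof -
  have "cdot (M *v v) (M *v v) = 0"
    using psd_Cauchy_Schwarz[OF assms(1), of "M *v v" v] assms(2) by simp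
  then have "inner (M *v v) (M *v v) = 0" by (metis Re_cdot zero_complex.sel(1))
  then show ?thesis by simp
qed

lemma closed_cost_sublevel:
  assumes bij: "bij (lyap_op A)" and V: "pos_def V" and R: "pos_def R"
  shows "closed (cost_sublevel A B V Q R a)"
  unfolding closed_sequential_limits
proof (intro allI impI, elim conjE)
  fix y l
  assume mem: "\<forall>n. y n \<in> cost_sublevel A B V Q R a" and lim: "y \<longlonglongrightarrow> l"
  let ?X = "X_of A B V"
  have posX: "pos_def (?X (y n))" and cost: "cost A B V Q R (y n) \<le> a" for n
    using mem by (auto simp: cost_sublevel_def stab_dom_def)
  have limX: "(\<lambda>n. ?X (y n)) \<longlonglongrightarrow> ?X l"
    using lim by (intro isCont_tendsto_compose[of l ?X] differentiable_imp_continuous_within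
        differentiable_X_of bij)
  have "(\<lambda>n. Re (trace (Q ** ?X (y n)))) \<longlonglongrightarrow> Re (trace (Q ** ?X l))"
    by (intro bounded_linear.tendsto[OF linear_Re_trace[THEN linear_conv_bounded_linear[THEN iffD1]]]
        matrix_mult.tendsto tendsto_const limX)
  \<comment> \<open>\<open>C\<close> bounds the \<open>Q\<close> part along the convergent sequence,
    so the \<open>R\<close> part of the cost is at most \<open>a + C\<close>.\<close>
  then obtain C where C: "\<And>n. norm (Re (trace (Q ** ?X (y n)))) \<le> C"
    using convergentI convergent_imp_Bseq BseqE by metis
  \<comment> \<open>The inverse has disappeared from this inequality, so it passes to the limit even
    though \<open>?X l\<close> is not yet known to be invertible.\<close>
  have bound: "inner (y n *v v) (R *v (y n *v v)) \<le> (a + C) * inner v (?X (y n) *v v)" for n v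
  proof -
    let ?N = "ctranspose (y n) ** R ** y n"
    have "inner v (?N *v v) \<le> Re (trace (?N ** matrix_inv (?X (y n)))) * inner v (?X (y n) *v v)"
      by (intro inner_le_trace_mult_inverse psd_congruence pos_def_imp_psd R posX)
    also have "\<dots> \<le> (a + C) * inner v (?X (y n) *v v)"
    proof (rule mult_right_mono)
      show "Re (trace (?N ** matrix_inv (?X (y n)))) \<le> a + C"
        using cost[of n] C[of n] by (simp add: cost_def trace_add)
      show "0 \<le> inner v (?X (y n) *v v)"
        using pos_def_imp_psd[OF posX] by (simp add: psd_def)
    qed
    finally show ?thesis by (simp add: inner_matrix flip: matrix_vector_mul_assoc)
  qed
  have limXv: "(\<lambda>n. inner v (?X (y n) *v v)) \<longlonglongrightarrow> inner v (?X l *v v)" for v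
    by (intro tendsto_intros matrix_vector.tendsto limX)
  have bound_l: "inner (l *v v) (R *v (l *v v)) \<le> (a + C) * inner v (?X l *v v)" for v
  proof (rule LIMSEQ_le)
    show "(\<lambda>n. inner (y n *v v) (R *v (y n *v v))) \<longlonglongrightarrow> inner (l *v v) (R *v (l *v v))"
      by (intro tendsto_intros matrix_vector.tendsto lim)
    show "(\<lambda>n. (a + C) * inner v (?X (y n) *v v)) \<longlonglongrightarrow> (a + C) * inner v (?X l *v v)"
      by (intro tendsto_intros limXv)
  qed (use bound in blast)
  have herm: "ctranspose (?X l) = ?X l"
    using V by (intro ctranspose_X_of bij) (simp add: pos_def_iff)
  moreover have "0 \<le> inner v (?X l *v v)" for v
    by (rule LIMSEQ_le_const[OF limXv]) (use pos_def_imp_psd[OF posX] in \<open>auto simp: psd_def\<close>)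
  ultimately have psdX: "psd (?X l)" by (simp add: psd_def)
  have "inner v (?X l *v v) \<noteq> 0" if v: "v \<noteq> 0" for v
  proof
    assume 0: "inner v (?X l *v v) = 0"
    then have Xv: "?X l *v v = 0" by (rule psd_kernel[OF psdX])
    have lv: "l *v v = 0" using bound_l[of v] 0 R by (force simp: pos_def_iff)
    \<comment> \<open>Every term of the two operators, tested against \<open>v\<close>, contains
      \<open>?X l *v v\<close> or \<open>l *v v\<close>, both zero; only the \<open>V\<close> term
      remains.\<close>
    have "inner v (lyap_op A (?X l) *v v) = inner v (A *v (?X l *v v))
        + inner (?X l *v v) (ctranspose A *v v)"
      by (simp add: lyap_op_def matrix_vector_mult_add_rdistrib inner_add_right inner_matrix[of v "?X l"]
          herm flip: matrix_vector_mul_assoc)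
    moreover have "inner v (input_op B l *v v) = inner v (B *v (l *v v))
        + inner (l *v v) (ctranspose B *v v)"
      by (simp add: input_op_def matrix_vector_mult_add_rdistrib inner_add_right
          inner_matrix[of v "ctranspose l"] flip: matrix_vector_mul_assoc)
    ultimately have "inner v (V *v v) = 0"
      using lyap_op_X_of[OF bij, of B V l] Xv lv
      by (simp add: matrix_vector_mult_diff_rdistrib inner_diff_right)
    then show False using V v by (metis less_irrefl pos_def_iff)
  qed
  then have "pos_def (?X l)"
    using psdX by (simp add: pos_def_iff psd_def order_less_le)
  then have l: "l \<in> stab_dom A B V" by (simp add: stab_dom_def)
  \<comment> \<open>Continuity of the cost at \<open>l\<close> is available only now that
    \<open>l\<close> is known to lie in the domain.\<close>
  have "(\<lambda>n. cost A B V Q R (y n)) \<longlonglongrightarrow> cost A B V Q R l"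
    using lim by (intro isCont_tendsto_compose[of l "cost A B V Q R"]
        differentiable_imp_continuous_within differentiable_cost bij l)
  then have "cost A B V Q R l \<le> a" by (rule LIMSEQ_le_const2) (use cost in auto)
  with l show "l \<in> cost_sublevel A B V Q R a" by (simp add: cost_sublevel_def)
qed

section \<open>The row-norm regularizer and the contraction of the iterates\<close>

lemma row_reg_nonneg: "(\<And>i. 0 \<le> w i) \<Longrightarrow> 0 \<le> row_reg w Y"
  unfolding row_reg_def by (simp add: sum_nonneg)

lemma convex_row_reg:
  fixes w :: "'m::finite \<Rightarrow> real"
  assumes "\<And>i. 0 \<le> w i"
  shows "convex_on UNIV (row_reg w :: complex^'n^'m \<Rightarrow> real)"
proof (rule convex_onI)
  fix t :: real and Y Z :: "complex^'n^'m"
  assume t: "0 < t" "t < 1"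
  have "norm (row i ((1 - t) *\<^sub>R Y + t *\<^sub>R Z)) \<le> (1 - t) * norm (row i Y) + t * norm (row i Z)" for i
  proof -
    have "row i ((1 - t) *\<^sub>R Y + t *\<^sub>R Z) = (1 - t) *\<^sub>R row i Y + t *\<^sub>R row i Z"
      by (simp add: row_def vec_eq_iff)
    then show ?thesis
      using norm_triangle_ineq[of "(1 - t) *\<^sub>R row i Y" "t *\<^sub>R row i Z"] t by simp
  qed
  then have "row_reg w ((1 - t) *\<^sub>R Y + t *\<^sub>R Z)
      \<le> (\<Sum>i\<in>UNIV. w i * ((1 - t) * norm (row i Y) + t * norm (row i Z)))"
    unfolding row_reg_def by (intro sum_mono mult_left_mono assms)
  also have "\<dots> = (1 - t) * row_reg w Y + t * row_reg w Z"
    by (simp add: row_reg_def distrib_left sum.distrib sum_distrib_left mult.left_commute)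
  finally show "row_reg w ((1 - t) *\<^sub>R Y + t *\<^sub>R Z) \<le> (1 - t) * row_reg w Y + t * row_reg w Z" .
qed simp

text \<open>The equivalence with \<open>Z = Ystar\<close> states existence and uniqueness of the
  global optimum at once, so the contraction is towards that very point.\<close>

theorem theorem1:
  fixes A V Q :: "complex^'n^'n"
    and B :: "complex^'m^'n"
    and R :: "complex^'m^'m"
    and w :: "'m \<Rightarrow> real"
    and \<gamma> a \<mu>\<^sub>a L\<^sub>a \<alpha> :: real
    and Y0 :: "complex^'n^'m"
    and Y :: "nat \<Rightarrow> complex^'n^'m"
  assumes "CARD('m) \<le> CARD('n)"
    and "controllable A B"
    and "pos_def V" and "pos_def Q" and "pos_def R"
    and "bij (lyap_op A)"
    and "\<And>i. 0 < w i"
    and "0 < \<gamma>"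
    and "Y0 \<in> stab_dom A B V"
    and "cost A B V Q R Y0 + \<gamma> * row_reg w Y0 < a"
    and "0 < \<mu>\<^sub>a"
    and "strongly_convex_on (cost_sublevel A B V Q R a) (cost A B V Q R) \<mu>\<^sub>a"
    and "0 < L\<^sub>a"
    and "L\<^sub>a-lipschitz_on (cost_sublevel A B V Q R a) (grad (cost A B V Q R))"
    and "\<alpha> \<in> {0 .. 1 / L\<^sub>a}"
    and "Y 0 = Y0"
    and "\<And>k. Y (Suc k) =
           prox (\<lambda>Z. \<gamma> * \<alpha> * row_reg w Z) (Y k - \<alpha> *\<^sub>R grad (cost A B V Q R) (Y k))"
  shows "\<exists>Ystar.
           (\<forall>Z. is_arg_min (\<lambda>Z. cost A B V Q R Z + \<gamma> * row_reg w Z) (\<lambda>Z. Z \<in> stab_dom A B V) Z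
                  \<longleftrightarrow> Z = Ystar) \<and>
           (\<forall>k. Y k \<in> stab_dom A B V) \<and>
           (\<forall>k. (norm (Y (Suc k) - Ystar))\<^sup>2 \<le> (1 - \<mu>\<^sub>a * \<alpha>) * (norm (Y k - Ystar))\<^sup>2)"
proof -
  have w: "\<And>i. 0 \<le> w i" using assms(7) by (simp add: less_imp_le)
  \<comment> \<open>The weight \<open>\<gamma>\<close> is absorbed into the abstract
    \<open>g\<close>, so that \<open>\<alpha> * g\<close> is the function whose prox the iteration
    takes.\<close>
  interpret composite_sublevel "cost A B V Q R" "\<lambda>Z. \<gamma> * row_reg w Z" "stab_dom A B V" a \<mu>\<^sub>a L\<^sub>a
  proof
    show "open (stab_dom A B V)"
      using assms(3,6) by (intro open_stab_dom) (simp_all add: pos_def_iff)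
    show "Z \<in> stab_dom A B V \<Longrightarrow> cost A B V Q R differentiable (at Z)" for Z
      by (rule differentiable_cost[OF assms(6)])
    show "convex_on UNIV (\<lambda>Z. \<gamma> * row_reg w Z)"
      using assms(8) by (intro convex_on_cmul convex_row_reg w) simp
    show "0 \<le> \<gamma> * row_reg w Z" for Z
      using assms(8) row_reg_nonneg[of w Z] w by simp
    show "closed {Z \<in> stab_dom A B V. cost A B V Q R Z \<le> a}"
      using closed_cost_sublevel[OF assms(6,3,5)] by (simp add: cost_sublevel_def)
    show "strongly_convex_on {Z \<in> stab_dom A B V. cost A B V Q R Z \<le> a} (cost A B V Q R) \<mu>\<^sub>a"
      using assms(12) by (simp only: cost_sublevel_def)
    show "L\<^sub>a-lipschitz_on {Z \<in> stab_dom A B V. cost A B V Q R Z \<le> a} (grad (cost A B V Q R))"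
      using assms(14) by (simp only: cost_sublevel_def)
  qed (fact assms(11,13))+
  obtain Ystar where Ystar: "is_arg_min (\<lambda>Z. cost A B V Q R Z + \<gamma> * row_reg w Z)
      (\<lambda>Z. Z \<in> stab_dom A B V) Z \<longleftrightarrow> Z = Ystar" for Z
    using ex_unique_minimizer[OF assms(9,10)] by metis
  have "Y (Suc k) = step \<alpha> (Y k)" for k
    using assms(17)[of k] by (simp add: step_def mult_ac)
  then show ?thesis
    using iterates_contract[of \<alpha> Y Ystar] assms(9,10,15,16) Ystar by (intro exI[of _ Ystar]) auto
qed

end
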